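(* Let $(t_0,x_0)\in\mathbb{R}^2$, let $D$ be a relatively open neighborhood of $(t_0,x_0)$ in the half-plane $\{(t,x)\in\mathbb{R}^2 : t\ge t_0\}$, and let $f:D\to\mathbb{R}$ be continuous in $D$. Then there exists $L>0$ such that the initial value problem $$x'(t)=f(t,x(t)),\quad t\ge t_0,\qquad x(t_0)=x_0,$$ has the greatest and the least solutions defined on the interval $I=[t_0,t_0+L]$; that is, there exist solutions (maybe identical) $x_*,\,x^*:I\to\mathbb{R}$ such that any other solution $x:I\to\mathbb{R}$ satisfies $$x_*(t)\le x(t)\le x^*(t)\quad\text{for all } t\in I.$$
   Context: A solution of the initial value problem on a nondegenerate interval $I$ with minimum $t_0$ is a differentiable function $x:I\to\mathbb{R}$ (one-sided derivatives at endpoints belonging to $I$) such that $(t,x(t))\in D$ and $x'(t)=f(t,x(t))$ for all $t\in I$, and $x(t_0)=x_0$. *)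

theory Defs
  imports "HOL-Analysis.Analysis"
begin

definition nondegenerate_interval_with_min :: "real \<Rightarrow> real set \<Rightarrow> bool" where
  "nondegenerate_interval_with_min t0 I \<longleftrightarrow>
     is_interval I \<and> t0 \<in> I \<and> (\<forall>t\<in>I. t0 \<le> t) \<and> (\<exists>t\<in>I. t0 < t)"

text \<open>
  A function on \<open>I\<close> is represented by a total function; only its values on \<open>I\<close> matter.
  The derivative is taken within \<open>I\<close>: it is one-sided at the endpoints that belong to
  \<open>I\<close> and is the ordinary derivative at interior points.
\<close>

definition ivp_solution ::
  "(real \<times> real) set \<Rightarrow> (real \<times> real \<Rightarrow> real) \<Rightarrow> real \<Rightarrow> real \<Rightarrow> real set \<Rightarrow> (real \<Rightarrow> real) \<Rightarrow> bool" where
  "ivp_solution D f t0 x0 I x \<longleftrightarrow>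
     nondegenerate_interval_with_min t0 I \<and>
     (\<forall>t\<in>I. (t, x t) \<in> D \<and> (x has_real_derivative f (t, x t)) (at t within I)) \<and>
     x t0 = x0"

end

(* Tonelli's delayed equation yields functions y_n with g(t, y_n) < y_n' <= g(t, y_n) + 1/(n+1).
   The strict inequality forces every y_n to lie above all solutions, so a uniform limit of a
   subsequence (Arzela-Ascoli) is a solution that lies above all solutions.  Reflecting x to -x
   gives the least solution.  Comparison with the lines of slope C and -C, where C > sup |f|,
   confines the solutions to a box inside D, on which f can be replaced by a bounded function
   defined on the whole plane. *)
theory Submission
  imports Defs "HOL-Complex_Analysis.Great_Picard"
begin

text \<open>Suppose \<open>x t > y t\<close>. At the last zero \<open>s\<close> of
  \<open>w = x - y\<close> before \<open>t\<close>, \<open>w\<close> has negative derivative, so it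
  is negative just to the right of \<open>s\<close> and must vanish again before \<open>t\<close>, a
  contradiction. Derivatives are compared only where the graphs meet. This suits differential
  equations: at a contact point both right-hand sides are evaluated at the same point of the
  plane.\<close>

lemma le_of_deriv_less_at_contact:
  fixes x y :: "real \<Rightarrow> real"
  assumes dx: "\<And>t. t \<in> {a..b} \<Longrightarrow> (x has_real_derivative x' t) (at t within {a..b})"
    and dy: "\<And>t. t \<in> {a..b} \<Longrightarrow> (y has_real_derivative y' t) (at t within {a..b})"
    and init: "x a \<le> y a"
    and contact: "\<And>t. t \<in> {a..b} \<Longrightarrow> x t = y t \<Longrightarrow> x' t < y' t"
    and t: "t \<in> {a..b}"
  shows "x t \<le> y t"
proof (rule ccontr)
  assume neg: "\<not> x t \<le> y t"
  define w where "w = (\<lambda>s. x s - y s)"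
  have dw: "(w has_real_derivative x' s - y' s) (at s within {a..b})" if "s \<in> {a..b}" for s
    unfolding w_def using dx dy that by (intro DERIV_diff) auto
  have cw: "continuous_on {a..b} w"
    using dw by (meson DERIV_continuous continuous_on_eq_continuous_within)
  define S where "S = {s \<in> {a..t}. w s = 0}"
  have cwt: "continuous_on {a..t} w"
    using cw t by (elim continuous_on_subset) auto
  have "closed S"
    unfolding S_def using continuous_closed_preimage_constant[OF cwt] by auto
  moreover have bdd: "bdd_above S"
    unfolding S_def by (rule bdd_aboveI[where M=t]) auto
  moreover have "S \<noteq> {}"
    using IVT'[of w a 0 t] cwt t neg init unfolding S_def w_def by force
  ultimately have "Sup S \<in> S"
    by (intro closed_contains_Sup)
  define s where "s = Sup S"
  have s: "s \<in> {a..t}" "w s = 0"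
    using \<open>Sup S \<in> S\<close> by (auto simp: S_def s_def)
  have st: "s < t"
    using s neg by (cases "s = t") (auto simp: w_def)
  have "x' s - y' s < 0"
    using contact[of s] s t by (auto simp: w_def)
  then obtain d where d: "d > 0" "\<And>h. h > 0 \<Longrightarrow> s + h \<in> {a..b} \<Longrightarrow> h < d \<Longrightarrow> w (s + h) < w s"
    using has_real_derivative_neg_dec_right[OF dw[of s]] s t by auto
  define h where "h = min (d/2) (t - s)"
  have h: "h > 0" "h < d" "s + h \<le> t"
    using d st by (auto simp: h_def)
  have "w (s + h) < 0"
    using d(2)[of h] h s t by auto
  moreover have "continuous_on {s+h..t} w"
    using cwt s h by (elim continuous_on_subset) auto
  ultimately obtain r where r: "s + h \<le> r" "r \<le> t" "w r = 0"
    using IVT'[of w "s+h" 0 t] neg h by (auto simp: w_def)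
  then have "r \<in> S"
    using h s by (auto simp: S_def)
  then have "r \<le> s"
    unfolding s_def by (intro cSup_upper bdd)
  then show False
    using r h by simp
qed

lemma deriv_bound_dist_init:
  fixes y :: "real \<Rightarrow> real"
  assumes "\<And>t. t \<in> {a..b} \<Longrightarrow> (y has_real_derivative y' t) (at t within {a..b})"
    and "\<And>t. t \<in> {a..b} \<Longrightarrow> \<bar>y' t\<bar> \<le> B"
    and "0 \<le> B" "t \<in> {a..b}"
  shows "\<bar>y t - y a\<bar> \<le> B * (b - a)"
proof -
  have "\<bar>y t - y a\<bar> \<le> B * \<bar>t - a\<bar>"
    using field_differentiable_bound[of "{a..b}" y y' B t a] assms by auto
  also have "\<dots> \<le> B * (b - a)"
    using assms by (intro mult_left_mono) auto
  finally show ?thesis .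
qed

text \<open>Tonelli's construction solves
  \<open>y' t = g (t, y (max a (t - \<delta>))) + e/2\<close>, which needs no fixed point theorem
  because the right-hand side looks only at the past. For small \<open>\<delta>\<close> the delay
  changes the value of \<open>g\<close> by less than \<open>e/2\<close>, so
  \<open>y' t - g (t, y t)\<close> lies strictly between \<open>0\<close> and
  \<open>e\<close>.\<close>

lemma strict_supersolution_exists:
  fixes g :: "real \<times> real \<Rightarrow> real"
  assumes cont: "continuous_on UNIV g" and bound: "\<And>p. \<bar>g p\<bar> \<le> M"
    and ab: "a \<le> b" and e: "e > 0"
  obtains y y' where "y a = x0"
    "\<And>t. t \<in> {a..b} \<Longrightarrow> (y has_real_derivative y' t) (at t within {a..b})"
    "\<And>t. t \<in> {a..b} \<Longrightarrow> g (t, y t) < y' t"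
    "\<And>t. t \<in> {a..b} \<Longrightarrow> y' t \<le> g (t, y t) + e"
proof -
  define B where "B = M + e"
  have M0: "0 \<le> M" using bound[of "(0,0)"] by linarith
  have B: "B > 0" using M0 e by (simp add: B_def)
  \<comment> \<open>\<open>B\<close> will bound \<open>y'\<close> whatever the delay is, so the
    graph of \<open>y\<close> lies in a rectangle of half-height \<open>R\<close> known before
    \<open>\<delta>\<close> is chosen. Uniform continuity of \<open>g\<close> on this rectangle can
    therefore be used to choose \<open>\<delta>\<close>.\<close>
  define R where "R = B * (b - a)"
  have "compact ({a..b} \<times> {x0 - R..x0 + R})"
    by (intro compact_Times compact_Icc)
  then have "uniformly_continuous_on ({a..b} \<times> {x0 - R..x0 + R}) g"
    using cont by (intro compact_uniformly_continuous) (auto elim: continuous_on_subset)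
  then obtain d where d: "d > 0"
    and unif: "\<And>p q. p \<in> {a..b} \<times> {x0 - R..x0 + R} \<Longrightarrow> q \<in> {a..b} \<times> {x0 - R..x0 + R}
      \<Longrightarrow> dist q p < d \<Longrightarrow> dist (g q) (g p) < e/2"
    using e by (elim uniformly_continuous_onE[where \<epsilon>="e/2"]) auto
  \<comment> \<open>Over one delay a function with Lipschitz constant \<open>B\<close> moves by at
    most \<open>B * \<delta> = d/2 < d\<close>.\<close>
  define \<delta> where "\<delta> = d / (2 * B)"
  have \<delta>: "\<delta> > 0" using d B by (simp add: \<delta>_def)
  \<comment> \<open>The maximum replaces arguments before \<open>a\<close> by \<open>a\<close>,
    which amounts to a constant history before the initial time.\<close>
  define G where "G u s = g (s, u (max a (s - \<delta>))) + e/2" for u s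
  define F where "F u t = x0 + integral {a..t} (G u)" for u t
  define Y where "Y k = (F ^^ k) (\<lambda>_. x0)" for k
  have Y_Suc: "Y (Suc k) = F (Y k)" for k
    by (simp add: Y_def)
  have contG: "continuous_on {a..b} (G u)" if "continuous_on {a..b} u" for u
  proof -
    have "continuous_on {a..b} (\<lambda>s. u (max a (s - \<delta>)))"
      using \<delta> by (intro continuous_on_compose2[OF that] continuous_intros) auto
    then show ?thesis
      unfolding G_def by (intro continuous_intros continuous_on_compose2[OF cont]) auto
  qed
  have dF: "(F u has_real_derivative G u t) (at t within {a..b})"
    if "continuous_on {a..b} u" "t \<in> {a..b}" for u t
  proof -
    have "((\<lambda>t. x0 + integral {a..t} (G u)) has_real_derivative 0 + G u t) (at t within {a..b})"
      using that by (intro DERIV_add DERIV_const integral_has_real_derivative contG) auto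
    then show ?thesis by (simp add: F_def[abs_def])
  qed
  have contY: "continuous_on {a..b} (Y k)" for k
  proof (induction k)
    case 0
    then show ?case by (simp add: Y_def)
  next
    case (Suc k)
    show ?case
      unfolding Y_Suc using dF[OF Suc] by (meson DERIV_continuous continuous_on_eq_continuous_within)
  qed
  \<comment> \<open>Method of steps: \<open>F u\<close> up to time \<open>t\<close> depends on
    \<open>u\<close> only up to \<open>max a (t - \<delta>)\<close>, so each iteration settles one
    more interval of length \<open>\<delta>\<close>. For \<open>k = 0\<close> only
    \<open>t = a\<close> is concerned, where both sides are \<open>x0\<close>. Finitely many
    iterations thus give an exact fixed point of \<open>F\<close> on \<open>{a..b}\<close>.\<close>
  have stable: "Y (Suc k) t = Y k t" if "a \<le> t" "t \<le> a + real k * \<delta>" for k t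
    using that
  proof (induction k arbitrary: t)
    case 0
    then show ?case by (simp add: Y_def F_def)
  next
    case (Suc k)
    have "G (Y (Suc k)) s = G (Y k) s" if "s \<in> {a..t}" for s
    proof -
      have "s \<le> a + real k * \<delta> + \<delta>"
        using that Suc.prems by (simp add: algebra_simps)
      then have "Y (Suc k) (max a (s - \<delta>)) = Y k (max a (s - \<delta>))"
        using \<delta> by (intro Suc.IH) auto
      then show ?thesis by (simp add: G_def)
    qed
    then have "integral {a..t} (G (Y (Suc k))) = integral {a..t} (G (Y k))"
      by (rule Henstock_Kurzweil_Integration.integral_cong)
    then show ?case
      using Y_Suc[of "Suc k"] Y_Suc[of k] by (simp add: F_def)
  qed
  obtain K :: nat where "(b - a) / \<delta> \<le> real K"
    using real_arch_simple by blast
  then have K: "b \<le> a + real K * \<delta>"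
    using \<delta> by (simp add: field_simps)
  define y where "y = Y K"
  have y_eq: "y t = F y t" if "t \<in> {a..b}" for t
    using stable[of t K] that K by (simp add: y_def Y_Suc)
  have dy: "(y has_real_derivative G y t) (at t within {a..b})" if "t \<in> {a..b}" for t
    using dF[of y t] contY[of K] that y_eq
    by (intro has_field_derivative_transform_within[of "F y" _ _ _ 1 y]) (auto simp: y_def)
  have ya: "y a = x0"
    using y_eq[of a] ab by (simp add: F_def)
  have G_bd: "\<bar>G y t\<bar> \<le> B" for t
    using bound[of "(t, y (max a (t - \<delta>)))"] e unfolding G_def B_def abs_le_iff
    by (auto simp: field_simps)
  have y_bd: "y t \<in> {x0 - R..x0 + R}" if "t \<in> {a..b}" for t
    using deriv_bound_dist_init[OF dy G_bd _ that] B ya by (auto simp: R_def)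
  have close: "\<bar>g (t, y (max a (t - \<delta>))) - g (t, y t)\<bar> < e/2" if t: "t \<in> {a..b}" for t
  proof -
    have m: "max a (t - \<delta>) \<in> {a..b}"
      using t \<delta> by auto
    have "\<bar>y (max a (t - \<delta>)) - y t\<bar> \<le> B * \<bar>max a (t - \<delta>) - t\<bar>"
      using field_differentiable_bound[of "{a..b}" y "G y" B] dy G_bd m t by auto
    also have "\<dots> \<le> B * \<delta>"
      using B t \<delta> by (intro mult_left_mono) auto
    also have "\<dots> < d"
      using B d by (simp add: \<delta>_def)
    finally have "dist (t, y (max a (t - \<delta>))) (t, y t) < d"
      by (simp add: dist_Pair_Pair dist_real_def)
    then show ?thesis
      using unif[of "(t, y t)" "(t, y (max a (t - \<delta>)))"] t y_bd[OF t] y_bd[OF m]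
      by (auto simp: dist_real_def)
  qed
  show thesis
  proof (rule that[of y "G y"])
    fix t assume t: "t \<in> {a..b}"
    show "g (t, y t) < G y t" "G y t \<le> g (t, y t) + e"
      using close[OF t] unfolding G_def by linarith+
  qed (use ya dy in auto)
qed

text \<open>The functions \<open>Y n\<close> are strict supersolutions with error at most
  \<open>1 / real (Suc n)\<close>. They share a Lipschitz constant, so a subsequence converges
  uniformly. Its limit is a solution because the errors vanish, and it is the greatest one because
  the inequality \<open>z t \<le> Y n t\<close> passes to the limit.\<close>

lemma greatest_solution_bounded:
  fixes g :: "real \<times> real \<Rightarrow> real"
  assumes cont: "continuous_on UNIV g" and bound: "\<And>p. \<bar>g p\<bar> \<le> M" and ab: "a \<le> b"
  obtains x where "x a = x0"
    "\<And>t. t \<in> {a..b} \<Longrightarrow> (x has_real_derivative g (t, x t)) (at t within {a..b})"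
    "\<And>z t. z a = x0 \<Longrightarrow>
       (\<And>s. s \<in> {a..b} \<Longrightarrow> (z has_real_derivative g (s, z s)) (at s within {a..b})) \<Longrightarrow>
       t \<in> {a..b} \<Longrightarrow> z t \<le> x t"
proof -
  have "\<exists>y y'. y a = x0 \<and> (\<forall>t\<in>{a..b}. (y has_real_derivative y' t) (at t within {a..b})
      \<and> g (t, y t) < y' t \<and> y' t \<le> g (t, y t) + 1 / real (Suc n))" for n :: nat
    by (rule strict_supersolution_exists[OF cont bound ab, of "1 / real (Suc n)" x0])
      (simp, blast)
  then obtain Y Y' where Ya: "\<And>n. Y n a = x0"
    and dY: "\<And>n t. t \<in> {a..b} \<Longrightarrow> (Y n has_real_derivative Y' n t) (at t within {a..b})"
    and lo: "\<And>n t. t \<in> {a..b} \<Longrightarrow> g (t, Y n t) < Y' n t"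
    and up: "\<And>n t. t \<in> {a..b} \<Longrightarrow> Y' n t \<le> g (t, Y n t) + 1 / real (Suc n)"
    by metis
  have M0: "0 \<le> M" using bound[of "(0,0)"] by linarith
  define B where "B = M + 1"
  have B: "B > 0" using M0 by (simp add: B_def)
  have Y'_bd: "\<bar>Y' n t\<bar> \<le> B" if "t \<in> {a..b}" for n t
  proof -
    have "1 / real (Suc n) \<le> 1" by simp
    then show ?thesis
      using lo[OF that, of n] up[OF that, of n] bound[of "(t, Y n t)"] unfolding B_def by linarith
  qed
  define R where "R = B * (b - a)"
  have Y_bd: "\<bar>Y n t - x0\<bar> \<le> R" if "t \<in> {a..b}" for n t
    using deriv_bound_dist_init[OF dY Y'_bd _ that, of n] B Ya[of n] by (auto simp: R_def)
  obtain x k where k: "strict_mono (k :: nat \<Rightarrow> nat)"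
    and unif: "\<And>e. 0 < e \<Longrightarrow> \<exists>N. \<forall>n t. n \<ge> N \<and> t \<in> {a..b} \<longrightarrow> norm (Y (k n) t - x t) < e"
  proof (rule Arzela_Ascoli[of "{a..b}" Y "\<bar>x0\<bar> + R"])
    show "norm (Y n t) \<le> \<bar>x0\<bar> + R" if "t \<in> {a..b}" for n t
      using Y_bd[OF that, of n] by auto
    show "\<exists>d>0. \<forall>n s. s \<in> {a..b} \<and> norm (t - s) < d \<longrightarrow> norm (Y n t - Y n s) < e"
      if t: "t \<in> {a..b}" and e: "0 < e" for t e
    proof (intro exI conjI allI impI)
      show "e / B > 0" using e B by simp
      fix n s assume s: "s \<in> {a..b} \<and> norm (t - s) < e / B"
      have "norm (Y n t - Y n s) \<le> B * norm (t - s)"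
        using field_differentiable_bound[of "{a..b}" "Y n" "Y' n" B t s] dY Y'_bd s t by auto
      also have "\<dots> < e"
        using s B by (simp add: field_simps)
      finally show "norm (Y n t - Y n s) < e" .
    qed
  qed (auto intro: that)
  have lim: "(\<lambda>n. Y (k n) t) \<longlonglongrightarrow> x t" if "t \<in> {a..b}" for t
    using unif that by (intro LIMSEQ_I) blast
  have x_bd: "\<bar>x t - x0\<bar> \<le> R" if "t \<in> {a..b}" for t
    using LIMSEQ_le_const2[OF tendsto_rabs[OF tendsto_diff[OF lim[OF that] tendsto_const]]]
      Y_bd[OF that] by blast
  have "compact ({a..b} \<times> {x0 - R..x0 + R})"
    by (intro compact_Times compact_Icc)
  then have ug: "uniformly_continuous_on ({a..b} \<times> {x0 - R..x0 + R}) g"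
    using cont by (intro compact_uniformly_continuous) (auto elim: continuous_on_subset)
  \<comment> \<open>The derivatives converge uniformly too: \<open>e/2\<close> pays for replacing
    \<open>Y (k n) t\<close> by \<open>x t\<close> inside \<open>g\<close>, and \<open>e/2\<close>
    for the supersolution error, which is small because \<open>k n \<ge> n\<close>.\<close>
  have unif': "\<forall>\<^sub>F n in sequentially. \<forall>t\<in>{a..b}. \<bar>Y' (k n) t - g (t, x t)\<bar> \<le> e" if e: "e > 0" for e
  proof -
    obtain d where d: "d > 0"
      and ud: "\<And>p q. p \<in> {a..b} \<times> {x0 - R..x0 + R} \<Longrightarrow> q \<in> {a..b} \<times> {x0 - R..x0 + R}
        \<Longrightarrow> dist q p < d \<Longrightarrow> dist (g q) (g p) < e/2"
      using uniformly_continuous_onE[OF ug half_gt_zero[OF e]] by blast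
    obtain N1 where N1: "\<And>n t. n \<ge> N1 \<Longrightarrow> t \<in> {a..b} \<Longrightarrow> norm (Y (k n) t - x t) < d"
      using unif[OF d] by blast
    obtain N2 :: nat where N2: "1 / real (Suc N2) < e/2"
      using nat_approx_posE[of "e/2"] e by auto
    show ?thesis
    proof (rule eventually_sequentiallyI[of "max N1 N2"], rule ballI)
      fix n t assume n: "max N1 N2 \<le> n" and t: "t \<in> {a..b}"
      have "real (Suc N2) \<le> real (Suc (k n))"
        using n seq_suble[OF k, of n] by simp
      then have "1 / real (Suc (k n)) \<le> 1 / real (Suc N2)"
        by (intro divide_left_mono) auto
      moreover have "\<bar>g (t, Y (k n) t) - g (t, x t)\<bar> < e/2"
      proof -
        have "(t, x t) \<in> {a..b} \<times> {x0 - R..x0 + R}" "(t, Y (k n) t) \<in> {a..b} \<times> {x0 - R..x0 + R}"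
          using t x_bd[OF t] Y_bd[OF t, of "k n"] by (auto simp: abs_le_iff)
        moreover have "dist (t, Y (k n) t) (t, x t) < d"
          using N1[of n t] n t by (simp add: dist_Pair_Pair dist_real_def)
        ultimately show ?thesis
          using ud by (metis dist_real_def)
      qed
      ultimately show "\<bar>Y' (k n) t - g (t, x t)\<bar> \<le> e"
        using lo[OF t, of "k n"] up[OF t, of "k n"] N2 by linarith
    qed
  qed
  \<comment> \<open>Uniform convergence of the derivatives together with convergence at
    \<open>a\<close> permits differentiating the limit. The theorem supplies its own limit
    \<open>u\<close>, which is then identified with \<open>x\<close> by uniqueness of
    limits.\<close>
  have "\<exists>u. \<forall>t\<in>{a..b}. (\<lambda>n. Y (k n) t) \<longlonglongrightarrow> u t \<and>
      (u has_derivative (*) (g (t, x t))) (at t within {a..b})"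
  proof (rule has_derivative_sequence)
    show "(Y (k n) has_derivative (*) (Y' (k n) t)) (at t within {a..b})" if "t \<in> {a..b}" for n t
      using dY[OF that] by (simp add: has_field_derivative_def)
    show "\<forall>\<^sub>F n in sequentially. \<forall>t\<in>{a..b}. \<forall>h. norm (Y' (k n) t * h - g (t, x t) * h) \<le> e * norm h"
      if "e > 0" for e
      using unif'[OF that]
      by eventually_elim (auto simp: abs_mult simp flip: left_diff_distrib intro: mult_right_mono)
    show "(\<lambda>n. Y (k n) a) \<longlonglongrightarrow> x0"
      by (simp add: Ya)
  qed (use ab in auto)
  then obtain u where u: "\<And>t. t \<in> {a..b} \<Longrightarrow> (\<lambda>n. Y (k n) t) \<longlonglongrightarrow> u t"
    and du: "\<And>t. t \<in> {a..b} \<Longrightarrow> (u has_derivative (*) (g (t, x t))) (at t within {a..b})"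
    by blast
  have xu: "x t = u t" if "t \<in> {a..b}" for t
    using LIMSEQ_unique[OF lim u] that by blast
  show thesis
  proof (rule that[of x])
    show "x a = x0"
      using lim[of a] ab by (simp add: Ya LIMSEQ_const_iff)
    show "(x has_real_derivative g (t, x t)) (at t within {a..b})" if "t \<in> {a..b}" for t
      unfolding has_field_derivative_def
      using has_derivative_transform[OF that xu du[OF that]] by simp
    show "z t \<le> x t" if z: "z a = x0"
      "\<And>s. s \<in> {a..b} \<Longrightarrow> (z has_real_derivative g (s, z s)) (at s within {a..b})"
      and t: "t \<in> {a..b}" for z t
    proof -
      \<comment> \<open>Where \<open>z\<close> meets \<open>Y n\<close>, the slope of
        \<open>z\<close> is \<open>g (s, Y n s)\<close>, which is strictly below
        \<open>Y' n s\<close>.\<close>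
      have "z t \<le> Y n t" for n
        using z lo by (intro le_of_deriv_less_at_contact[OF z(2) dY _ _ t]) (auto simp: Ya)
      then show ?thesis
        using LIMSEQ_le_const[OF lim[OF t]] by blast
    qed
  qed
qed

lemma least_solution_bounded:
  fixes g :: "real \<times> real \<Rightarrow> real"
  assumes cont: "continuous_on UNIV g" and bound: "\<And>p. \<bar>g p\<bar> \<le> M" and ab: "a \<le> b"
  obtains x where "x a = x0"
    "\<And>t. t \<in> {a..b} \<Longrightarrow> (x has_real_derivative g (t, x t)) (at t within {a..b})"
    "\<And>z t. z a = x0 \<Longrightarrow>
       (\<And>s. s \<in> {a..b} \<Longrightarrow> (z has_real_derivative g (s, z s)) (at s within {a..b})) \<Longrightarrow>
       t \<in> {a..b} \<Longrightarrow> x t \<le> z t"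
proof -
  \<comment> \<open>If \<open>z\<close> solves the equation for \<open>g\<close>, then
    \<open>- z\<close> solves the one for \<open>g'\<close>, and conversely; negation reverses the
    order, so the greatest solution for \<open>g'\<close> yields the least one for
    \<open>g\<close>.\<close>
  define g' where "g' = (\<lambda>(t, v). - g (t, - v))"
  have "continuous_on UNIV g'"
    unfolding g'_def case_prod_unfold
    by (intro continuous_intros continuous_on_compose2[OF cont]) auto
  moreover have "\<bar>g' p\<bar> \<le> M" for p
    using bound by (auto simp: g'_def split: prod.split)
  ultimately obtain x where x: "x a = - x0"
    "\<And>t. t \<in> {a..b} \<Longrightarrow> (x has_real_derivative g' (t, x t)) (at t within {a..b})"
    "\<And>z t. z a = - x0 \<Longrightarrow>
       (\<And>s. s \<in> {a..b} \<Longrightarrow> (z has_real_derivative g' (s, z s)) (at s within {a..b})) \<Longrightarrow>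
       t \<in> {a..b} \<Longrightarrow> z t \<le> x t"
    using greatest_solution_bounded[OF _ _ ab, of g' M "- x0"] by blast
  show thesis
  proof (rule that[of "\<lambda>t. - x t"])
    show "((\<lambda>t. - x t) has_real_derivative g (t, - x t)) (at t within {a..b})" if "t \<in> {a..b}" for t
      using DERIV_minus[OF x(2)[OF that]] by (simp add: g'_def)
    show "- x t \<le> z t" if z: "z a = x0"
      "\<And>s. s \<in> {a..b} \<Longrightarrow> (z has_real_derivative g (s, z s)) (at s within {a..b})"
      and t: "t \<in> {a..b}" for z t
    proof -
      have "((\<lambda>s. - z s) has_real_derivative g' (s, - z s)) (at s within {a..b})"
        if "s \<in> {a..b}" for s
        using DERIV_minus[OF z(2)[OF that]] by (simp add: g'_def)
      then have "- z t \<le> x t"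
        using x(3)[of "\<lambda>s. - z s" t] z(1) t by auto
      then show ?thesis by simp
    qed
  qed (use x(1) in simp)
qed

text \<open>The lines of slope \<open>C\<close> and \<open>- C\<close> through
  \<open>(a, x0)\<close> stay within \<open>r\<close> of \<open>x0\<close> on \<open>{a..b}\<close>.
  A contact with either line thus happens inside the box, where \<open>\<bar>f\<bar> < C\<close>,
  and the comparison lemma forbids crossing. Hence the bound on \<open>f\<close> inside the box
  suffices, without knowing beforehand that \<open>z\<close> remains there.\<close>

lemma solution_stays_in_cone:
  fixes z :: "real \<Rightarrow> real"
  assumes dz: "\<And>s. s \<in> {a..b} \<Longrightarrow> (z has_real_derivative f (s, z s)) (at s within {a..b})"
    and za: "z a = x0" and C: "C * (b - a) \<le> r" "0 \<le> C"
    and bound: "\<And>s v. s \<in> {a..b} \<Longrightarrow> \<bar>v - x0\<bar> \<le> r \<Longrightarrow> \<bar>f (s, v)\<bar> < C"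
    and t: "t \<in> {a..b}"
  shows "\<bar>z t - x0\<bar> \<le> r"
proof -
  have r: "C * (s - a) \<le> r" "0 \<le> C * (s - a)" if "s \<in> {a..b}" for s
  proof -
    have "C * (s - a) \<le> C * (b - a)"
      using that C by (intro mult_left_mono) auto
    then show "C * (s - a) \<le> r" using C by linarith
    show "0 \<le> C * (s - a)" using that C by simp
  qed
  have dline: "((\<lambda>s. x0 + c * (s - a)) has_real_derivative c) (at s within {a..b})" for c s
    by (auto intro!: derivative_eq_intros)
  have "z t \<le> x0 + C * (t - a)"
  proof (rule le_of_deriv_less_at_contact[OF dz dline _ _ t])
    show "f (s, z s) < C" if "s \<in> {a..b}" "z s = x0 + C * (s - a)" for s
      using bound[of s "z s"] r[of s] that by auto
  qed (use za in auto)
  moreover have "x0 + (- C) * (t - a) \<le> z t"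
  proof (rule le_of_deriv_less_at_contact[OF dline dz _ _ t])
    show "- C < f (s, z s)" if "s \<in> {a..b}" "x0 + (- C) * (s - a) = z s" for s
      using bound[of s "z s"] r[of s] that by (auto simp flip: that(2))
  qed (use za in auto)
  ultimately show ?thesis
    using r[OF t] by (auto simp: abs_le_iff)
qed

theorem theorem2p1:
  fixes t0 x0 :: real and D :: "(real \<times> real) set" and f :: "real \<times> real \<Rightarrow> real"
  assumes "openin (top_of_set {(t, x). t \<ge> t0}) D"
    and "(t0, x0) \<in> D"
    and "continuous_on D f"
  shows "\<exists>L>0. \<exists>x_least x_greatest.
    ivp_solution D f t0 x0 {t0..t0 + L} x_least \<and>
    ivp_solution D f t0 x0 {t0..t0 + L} x_greatest \<and>
    (\<forall>x. ivp_solution D f t0 x0 {t0..t0 + L} x \<longrightarrow>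
         (\<forall>t\<in>{t0..t0 + L}. x_least t \<le> x t \<and> x t \<le> x_greatest t))"
proof -
  obtain T where T: "open T" "D = {(t, x). t \<ge> t0} \<inter> T"
    using assms(1) by (auto simp: openin_open)
  then obtain U V where UV: "open U" "open V" "t0 \<in> U" "x0 \<in> V" "U \<times> V \<subseteq> T"
    using assms(2) by (metis IntD2 open_prod_elim mem_Sigma_iff)
  obtain r1 r2 where r12: "r1 > 0" "cball t0 r1 \<subseteq> U" "r2 > 0" "cball x0 r2 \<subseteq> V"
    using UV by (meson open_contains_cball)
  define r where "r = min r1 r2"
  have r: "r > 0" using r12 by (simp add: r_def)
  \<comment> \<open>\<open>Q\<close> extends only to the right of \<open>t0\<close>, since
    \<open>D\<close> is a neighborhood only within the half-plane.\<close>
  define Q where "Q = {t0..t0 + r} \<times> {x0 - r..x0 + r}"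
  have QD: "Q \<subseteq> D"
  proof -
    have "{t0..t0 + r} \<subseteq> cball t0 r1" "{x0 - r..x0 + r} \<subseteq> cball x0 r2"
      by (auto simp: r_def dist_real_def)
    then have "Q \<subseteq> T"
      unfolding Q_def using r12 UV by blast
    then show ?thesis by (auto simp: T Q_def)
  qed
  have compQ: "compact Q"
    unfolding Q_def by (intro compact_Times compact_Icc)
  have contQ: "continuous_on Q f"
    using assms(3) QD by (rule continuous_on_subset)
  obtain M where M: "M \<ge> 0" "\<And>p. p \<in> Q \<Longrightarrow> norm (f p) \<le> M"
    using compact_imp_bounded[OF compact_continuous_image[OF contQ compQ]]
    unfolding bounded_pos by (meson imageI less_imp_le)
  \<comment> \<open>Tietze extends the restriction of \<open>f\<close> to \<open>Q\<close> to the
    whole plane with the same bound \<open>M\<close>, which makes the lemmas for bounded right-hand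
    sides applicable.\<close>
  have "closedin (top_of_set UNIV) Q"
    using compact_imp_closed[OF compQ] by simp
  then obtain g where g: "continuous_on UNIV g" "\<And>p. p \<in> Q \<Longrightarrow> g p = f p" "\<And>p. norm (g p) \<le> M"
    using Tietze[OF contQ _ M] by (metis UNIV_I)
  \<comment> \<open>The extra \<open>1\<close> gives the strict bound that the cone lemma requires;
    \<open>L \<le> r / C\<close> then keeps the cone inside \<open>Q\<close> up to time
    \<open>t0 + L\<close>.\<close>
  define C where "C = M + 1"
  have C: "C > 0" using M by (simp add: C_def)
  define L where "L = min r (r / C)"
  have L: "L > 0" "L \<le> r" "C * (t0 + L - t0) \<le> r"
    using r C by (auto simp: L_def min_def field_simps)
  have inQ: "(t, v) \<in> Q" if "t \<in> {t0..t0 + L}" "\<bar>v - x0\<bar> \<le> r" for t v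
    using that L by (auto simp: Q_def abs_le_iff)
  have gbd: "\<bar>g p\<bar> \<le> M" for p
    using g(3)[of p] by simp
  have LL: "t0 \<le> t0 + L" using L by simp
  have nondeg: "nondegenerate_interval_with_min t0 {t0..t0 + L}"
    unfolding nondegenerate_interval_with_min_def using L is_interval_cc
    by (auto intro!: bexI[of _ "t0 + L"])
  let ?gsol = "\<lambda>x. x t0 = x0 \<and>
    (\<forall>t\<in>{t0..t0 + L}. (x has_real_derivative g (t, x t)) (at t within {t0..t0 + L}))"
  \<comment> \<open>Solutions of either problem are confined to \<open>Q\<close>, where
    \<open>f\<close> and \<open>g\<close> agree. One direction makes the extremal solutions for
    \<open>g\<close> solutions in \<open>D\<close>; the other makes them extremal among all
    solutions in \<open>D\<close>, including those not assumed to stay in \<open>Q\<close>.\<close>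
  have sol_iff: "ivp_solution D f t0 x0 {t0..t0 + L} x \<longleftrightarrow> ?gsol x" for x
  proof
    assume x: "ivp_solution D f t0 x0 {t0..t0 + L} x"
    have "\<bar>x t - x0\<bar> \<le> r" if "t \<in> {t0..t0 + L}" for t
    proof (rule solution_stays_in_cone[OF _ _ L(3) _ _ that])
      show "\<bar>f (s, v)\<bar> < C" if "s \<in> {t0..t0 + L}" "\<bar>v - x0\<bar> \<le> r" for s v
        using M(2)[OF inQ[OF that]] by (simp add: C_def)
    qed (use x C in \<open>auto simp: ivp_solution_def\<close>)
    then show "?gsol x"
      using x g(2) inQ unfolding ivp_solution_def by auto
  next
    assume x: "?gsol x"
    have "(t, x t) \<in> Q" if "t \<in> {t0..t0 + L}" for t
    proof (rule inQ[OF that], rule solution_stays_in_cone[OF _ _ L(3) _ _ that])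
      show "\<bar>g (s, v)\<bar> < C" for s v
        using gbd[of "(s, v)"] by (simp add: C_def)
    qed (use x C in auto)
    then show "ivp_solution D f t0 x0 {t0..t0 + L} x"
      using x g(2) QD nondeg unfolding ivp_solution_def by auto
  qed
  obtain xl where xl: "?gsol xl" "\<And>z t. ?gsol z \<Longrightarrow> t \<in> {t0..t0 + L} \<Longrightarrow> xl t \<le> z t"
    by (rule least_solution_bounded[OF g(1) gbd LL, of x0]) blast
  obtain xg where xg: "?gsol xg" "\<And>z t. ?gsol z \<Longrightarrow> t \<in> {t0..t0 + L} \<Longrightarrow> z t \<le> xg t"
    by (rule greatest_solution_bounded[OF g(1) gbd LL, of x0]) blast
  show ?thesis
  proof (rule exI[of _ L], rule conjI[OF L(1)], rule exI[of _ xl], rule exI[of _ xg],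
      intro conjI allI impI ballI)
    show "ivp_solution D f t0 x0 {t0..t0 + L} xl" "ivp_solution D f t0 x0 {t0..t0 + L} xg"
      using xl(1) xg(1) sol_iff by blast+
    show "xl t \<le> x t" "x t \<le> xg t"
      if "ivp_solution D f t0 x0 {t0..t0 + L} x" "t \<in> {t0..t0 + L}" for x t
      using xl(2) xg(2) that unfolding sol_iff by blast+
  qed
qed

end
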